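(* Suppose that for every $j\in V$ the cost function $f_j:\mathbb R\to\mathbb R$ is strictly convex and differentiable and attains its minimum at $0$ with $f_j(0)=0$. Let $h>0$, let $g_j=f_j'$, and consider the decentralized control $$\dot v_j=-h\,\omega_j,\qquad u_j=g_j^{-1}(v_j),\qquad j\in V,$$ applied after a perturbation in which the uncontrollable power at one (arbitrary) bus changes by $\Delta p$, i.e. $p_k=p^0_k+\Delta p$ for some bus $k\in V$ and $p_j=p^0_j$ for $j\neq k$. Then the steady-state cost $\sum_{j\in V}f_j(u_j)$ under this control is at most $$\frac{4(\Delta p)^2\,n\,h}{b\,\lambda_2}$$ more than the optimal cost, where $n=|V|$, $\lambda_2$ is the algebraic connectivity of the unweighted graph $G$, and $b$ is the minimum absolute value of the power line susceptances.
   Context: The power grid is a connected graph $G=(V,E)$ with $n=|V|$ buses and $m=|E|$ power lines; $V$ is partitioned into generator buses $V_G$ and load buses $V_L$. Lines are lossless, and $B_{jk}=B_{kj}>0$ is the absolute value of the susceptance of line $(j,k)\in E$ ($B_{jk}=0$ if $(j,k)\notin E$); $b=\min_{(j,k)\in E}B_{jk}$. The algebraic connectivity $\lambda_2$ is the second smallest eigenvalue of the unweighted graph Laplacian of $G$. At bus $j$, $\theta_j$ is the phase angle (in the frame rotating at nominal frequency), $\omega_j=\dot\theta_j$ is the frequency deviation from nominal, $p_j$ is the unadjustable net generation (positive for generation, negative for load), $u_j$ is the controllable net generation, and $v_j$ is a virtual price maintained by the controller. The DC power flow dynamics, with inertias $M_j>0$ and coefficients $D_j>0$, are $$M_j\dot\omega_j=-D_j\omega_j+p_j+u_j-\sum_{k\in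 V}B_{jk}(\theta_j-\theta_k)\quad (j\in V_G),$$ $$0=-D_j\omega_j+p_j+u_j-\sum_{k\in V}B_{jk}(\theta_j-\theta_k)\quad (j\in V_L).$$ $f_j(u)$ is the cost of increasing the net generation at bus $j$ by $u$. Its derivative $g_j=f_j'$ is increasing, and the inverse $g_j^{-1}(v)$ is taken to be well defined (i.e. $g_j$ is treated as a bijection). Before the perturbation the system is in steady state with $u=0$, $v=0$, $\omega=0$, unadjustable power $p^0$ with $\sum_{j}p^0_j=0$, and phase angles $\theta^0$ satisfying $p^0_j=\sum_{k}B_{jk}(\theta^0_j-\theta^0_k)$ for all $j$. At time $0$ the unadjustable power changes to the constant vector $p$, and the controlled dynamics evolve from $\theta(0)=\theta^0$, $v(0)=0$, $u(0)=0$ (and $\omega_j(0)=0$ for $j\in V_G$). The steady state after the perturbation is the state $(\theta,v,u)$ with $\omega=0$, $\dot\omega=0$ in which the controlled system settles; in it $p_j+u_j=\sum_kB_{jk}(\theta_j-\theta_k)$ for all $j\in V$, and, integrating the control law, $v_j=-h(\theta_j-\theta_j^0)$ and $u_j=g_j^{-1}(v_j)$ for all $j\in V$. The optimal cost is the minimum of $\sum_{j\in V}f_j(u_j)$ over $(u,\theta)\in\mathbb R^n\times\mathbb R^n$ subject to $p_j+u_j-\sum_{k\in V}B_{jk}(\theta_j-\theta_k)=0$ for all $j\in V$, with $p$ the unadjustable power after the perturbation. Line limits and generator capacity constraints are ignored. *)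

theory Defs
  imports "HOL-Analysis.Analysis"
begin

section \<open>Strict convexity\<close>

definition strictly_convex :: "(real \<Rightarrow> real) \<Rightarrow> bool" where
  "strictly_convex f \<longleftrightarrow>
     (\<forall>x y t. x \<noteq> y \<longrightarrow> 0 < t \<longrightarrow> t < 1 \<longrightarrow>
        f ((1 - t) * x + t * y) < (1 - t) * f x + t * f y)"

section \<open>Graphs and algebraic connectivity\<close>

text \<open>
  The buses are the elements of a finite type. The lines are a symmetric irreflexive relation,
  so an undirected line \<open>{j, k}\<close> appears as both \<open>(j, k)\<close> and \<open>(k, j)\<close>.
\<close>

definition connected_simple_graph :: "('v::finite \<times> 'v) set \<Rightarrow> bool" where
  "connected_simple_graph E \<longleftrightarrow> sym E \<and> irrefl E \<and> (\<forall>x y. (x, y) \<in> E\<^sup>*)"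

definition graph_laplacian :: "('v::finite \<times> 'v) set \<Rightarrow> real^'v^'v" where
  "graph_laplacian E =
     (\<chi> i j. if i = j then real (card (E `` {i})) else if (i, j) \<in> E then - 1 else 0)"

definition eigenspace :: "real^'v^'v \<Rightarrow> real \<Rightarrow> (real^'v::finite) set" where
  "eigenspace A \<mu> = {x. A *v x = \<mu> *\<^sub>R x}"

definition eigenvalues :: "real^'v^'v::finite \<Rightarrow> real set" where
  "eigenvalues A = {\<mu>. \<exists>x. x \<noteq> 0 \<and> A *v x = \<mu> *\<^sub>R x}"

text \<open>
  Multiplicity is geometric multiplicity; for the symmetric matrices considered here it coincides
  with the algebraic one.
\<close>

definition eigenvalue_mset :: "real^'v^'v::finite \<Rightarrow> real multiset" where
  "eigenvalue_mset A = (\<Sum>\<mu>\<in>eigenvalues A. replicate_mset (dim (eigenspace A \<mu>)) \<mu>)"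

text \<open>List positions start at \<open>0\<close>. The value is meaningful for at least two vertices.\<close>

definition algebraic_connectivity :: "('v::finite \<times> 'v) set \<Rightarrow> real" where
  "algebraic_connectivity E = sorted_list_of_multiset (eigenvalue_mset (graph_laplacian E)) ! 1"

section \<open>Power networks\<close>

text \<open>
  \<open>B j k\<close> is the absolute value of the susceptance of the line \<open>(j, k)\<close>.
\<close>

definition line_susceptances :: "('v::finite \<times> 'v) set \<Rightarrow> ('v \<Rightarrow> 'v \<Rightarrow> real) \<Rightarrow> bool" where
  "line_susceptances E B \<longleftrightarrow>
     (\<forall>j k. B j k = B k j) \<and>
     (\<forall>j k. (j, k) \<in> E \<longrightarrow> B j k > 0) \<and>
     (\<forall>j k. (j, k) \<notin> E \<longrightarrow> B j k = 0)"

definition min_susceptance :: "('v::finite \<times> 'v) set \<Rightarrow> ('v \<Rightarrow> 'v \<Rightarrow> real) \<Rightarrow> real" where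
  "min_susceptance E B = Min ((\<lambda>(j, k). B j k) ` E)"

definition net_outflow :: "('v::finite \<Rightarrow> 'v \<Rightarrow> real) \<Rightarrow> ('v \<Rightarrow> real) \<Rightarrow> 'v \<Rightarrow> real" where
  "net_outflow B \<theta> j = (\<Sum>k\<in>UNIV. B j k * (\<theta> j - \<theta> k))"

definition power_balanced ::
  "('v::finite \<Rightarrow> 'v \<Rightarrow> real) \<Rightarrow> ('v \<Rightarrow> real) \<Rightarrow> ('v \<Rightarrow> real) \<Rightarrow> ('v \<Rightarrow> real) \<Rightarrow> bool" where
  "power_balanced B p u \<theta> \<longleftrightarrow> (\<forall>j. p j + u j - net_outflow B \<theta> j = 0)"

definition total_cost :: "('v::finite \<Rightarrow> real \<Rightarrow> real) \<Rightarrow> ('v \<Rightarrow> real) \<Rightarrow> real" where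
  "total_cost f u = (\<Sum>j\<in>UNIV. f j (u j))"

text \<open>
  The least element of the set of attainable costs, not merely its infimum.
\<close>

definition optimal_cost ::
  "('v::finite \<Rightarrow> 'v \<Rightarrow> real) \<Rightarrow> ('v \<Rightarrow> real) \<Rightarrow> ('v \<Rightarrow> real \<Rightarrow> real) \<Rightarrow> real" where
  "optimal_cost B p f = (LEAST c. \<exists>u \<theta>. power_balanced B p u \<theta> \<and> c = total_cost f u)"

section \<open>Dynamics under decentralized control\<close>

text \<open>
  Trajectories have type \<open>'v \<Rightarrow> real \<Rightarrow> real\<close> (bus, then time) and are constrained on times
  \<open>t \<ge> 0\<close> only; at \<open>t = 0\<close> derivatives are one-sided. At load buses \<open>\<omega>\<close> is determined by an
  algebraic equation and need not be differentiable.
\<close>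

definition dc_dynamics ::
  "'v set \<Rightarrow> 'v set \<Rightarrow> ('v::finite \<Rightarrow> 'v \<Rightarrow> real) \<Rightarrow> ('v \<Rightarrow> real) \<Rightarrow> ('v \<Rightarrow> real) \<Rightarrow> ('v \<Rightarrow> real) \<Rightarrow>
   ('v \<Rightarrow> real \<Rightarrow> real) \<Rightarrow> ('v \<Rightarrow> real \<Rightarrow> real) \<Rightarrow> ('v \<Rightarrow> real \<Rightarrow> real) \<Rightarrow> bool" where
  "dc_dynamics VG VL B M D p \<theta> \<omega> u \<longleftrightarrow>
     (\<forall>t\<ge>0.
        (\<forall>j. (\<theta> j has_real_derivative \<omega> j t) (at t within {0..})) \<and>
        (\<forall>j\<in>VG. \<exists>a. (\<omega> j has_real_derivative a) (at t within {0..}) \<and>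
           M j * a = - D j * \<omega> j t + p j + u j t - net_outflow B (\<lambda>i. \<theta> i t) j) \<and>
        (\<forall>j\<in>VL. 0 = - D j * \<omega> j t + p j + u j t - net_outflow B (\<lambda>i. \<theta> i t) j))"

text \<open>The function \<open>g\<^sub>j\<close> is \<open>deriv (f j)\<close>; it is assumed to be a bijection where this is used.\<close>

definition decentralized_control ::
  "real \<Rightarrow> ('v \<Rightarrow> real \<Rightarrow> real) \<Rightarrow>
   ('v \<Rightarrow> real \<Rightarrow> real) \<Rightarrow> ('v \<Rightarrow> real \<Rightarrow> real) \<Rightarrow> ('v \<Rightarrow> real \<Rightarrow> real) \<Rightarrow> bool" where
  "decentralized_control h f \<omega> v u \<longleftrightarrow>
     (\<forall>t\<ge>0. \<forall>j.
        (v j has_real_derivative - h * \<omega> j t) (at t within {0..}) \<and>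
        u j t = inv (deriv (f j)) (v j t))"

text \<open>
  The trajectory settles in the steady state \<open>(\<theta>\<^sub>s, v\<^sub>s, u\<^sub>s)\<close>, where \<open>\<omega> = 0\<close> and the acceleration
  of \<open>\<theta>\<close> vanishes.
\<close>

definition settles_in ::
  "'v set \<Rightarrow> ('v \<Rightarrow> real \<Rightarrow> real) \<Rightarrow> ('v \<Rightarrow> real \<Rightarrow> real) \<Rightarrow> ('v \<Rightarrow> real \<Rightarrow> real) \<Rightarrow>
   ('v \<Rightarrow> real \<Rightarrow> real) \<Rightarrow> ('v \<Rightarrow> real) \<Rightarrow> ('v \<Rightarrow> real) \<Rightarrow> ('v \<Rightarrow> real) \<Rightarrow> bool" where
  "settles_in VG \<theta> \<omega> v u \<theta>\<^sub>s v\<^sub>s u\<^sub>s \<longleftrightarrow>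
     (\<forall>j. (\<theta> j \<longlongrightarrow> \<theta>\<^sub>s j) at_top \<and> (v j \<longlongrightarrow> v\<^sub>s j) at_top \<and> (u j \<longlongrightarrow> u\<^sub>s j) at_top \<and>
          (\<omega> j \<longlongrightarrow> 0) at_top) \<and>
     (\<forall>j\<in>VG. (deriv (\<omega> j) \<longlongrightarrow> 0) at_top)"

end

theory Submission
  imports Defs
begin

text \<open>
  Put \<open>\<phi> = \<theta>\<^sub>s - \<theta>\<^sub>0\<close>. In the steady state the weighted Laplacian of \<open>\<phi>\<close> equals \<open>\<Delta>p e\<^sub>k + u\<^sub>s\<close>, and \<open>u\<^sub>s\<close>
  has at every bus the sign opposite to \<open>\<phi>\<close>. By the minimum principle \<open>\<phi>\<close> then has constant sign, so
  the \<open>l\<^sup>1\<close> norm of \<open>u\<^sub>s\<close> is \<open>\<bar>\<Delta>p\<bar>\<close>. An optimal injection equalises the marginal costs, hence also has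
  constant sign and \<open>l\<^sup>1\<close> norm \<open>\<bar>\<Delta>p\<bar>\<close>. By convexity the cost gap is at most the sum of
  \<open>v\<^sub>j (u\<^sub>j - w\<^sub>j)\<close>, where \<open>u\<^sub>s\<close> and the optimum \<open>w\<close> have equal sums, so the mean of \<open>v = -h \<phi>\<close> may be
  subtracted and the gap is at most \<open>2 \<bar>\<Delta>p\<bar> h r\<close>, with \<open>r\<close> the \<open>l\<^sup>2\<close> norm of \<open>\<phi>\<close> minus its mean.
  Comparing the energy of \<open>\<phi>\<close>, at least \<open>b \<lambda>\<^sub>2 r\<^sup>2\<close> and at most \<open>2 \<bar>\<Delta>p\<bar> r\<close>, bounds \<open>r\<close>.
\<close>

section \<open>Marginal costs\<close>

lemma strictly_convex_imp_convex_on: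
  assumes "strictly_convex f"
  shows "convex_on UNIV f"
proof (rule convex_onI)
  fix t x y :: real
  assume t: "0 < t" "t < 1"
  show "f ((1 - t) *\<^sub>R x + t *\<^sub>R y) \<le> (1 - t) * f x + t * f y"
  proof (cases "x = y")
    case True
    have "(1 - t) * y + t * y = y" "(1 - t) * f y + t * f y = f y"
      by (simp_all add: algebra_simps)
    then show ?thesis using True by simp
  next
    case False
    then show ?thesis
      using assms t unfolding strictly_convex_def by (simp add: less_imp_le)
  qed
qed simp

lemma convex_on_deriv_above_tangent:
  fixes f :: "real \<Rightarrow> real"
  assumes "convex_on UNIV f" "f differentiable_on UNIV"
  shows "deriv f x * (y - x) \<le> f y - f x"
proof (rule convex_on_imp_above_tangent[OF assms(1)])
  show "(f has_field_derivative deriv f x) (at x within UNIV)"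
    using assms(2) by (auto simp: differentiable_on_def DERIV_deriv_iff_real_differentiable)
qed auto

text \<open>Adding the tangent inequalities at \<open>x\<close> and at \<open>y\<close> gives
  monotonicity; injectivity of the derivative makes it strict.\<close>

lemma convex_on_deriv_strict_mono:
  fixes f :: "real \<Rightarrow> real"
  assumes "convex_on UNIV f" "f differentiable_on UNIV" "inj (deriv f)"
  shows "strict_mono (deriv f)"
proof (rule strict_monoI)
  fix x y :: real
  assume "x < y"
  have "deriv f x * (y - x) \<le> deriv f y * (y - x)"
    using convex_on_deriv_above_tangent[OF assms(1,2), of x y]
      convex_on_deriv_above_tangent[OF assms(1,2), of y x]
    by (simp add: algebra_simps)
  then have "deriv f x \<le> deriv f y"
    using \<open>x < y\<close> by simp
  moreover have "deriv f x \<noteq> deriv f y"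
    using assms(3) \<open>x < y\<close> by (auto dest: injD)
  ultimately show "deriv f x < deriv f y" by simp
qed

lemma deriv_zero_at_minimum:
  fixes f :: "real \<Rightarrow> real"
  assumes "f differentiable_on UNIV" "\<And>x. f a \<le> f x"
  shows "deriv f a = 0"
proof (rule DERIV_local_min)
  show "DERIV f a :> deriv f a"
    using assms(1) by (auto simp: differentiable_on_def DERIV_deriv_iff_real_differentiable)
qed (use assms(2) in \<open>auto intro: zero_less_one\<close>)

section \<open>Inverse marginal costs\<close>

lemma strict_mono_inv_bij:
  fixes g :: "real \<Rightarrow> real"
  assumes "strict_mono g" "bij g"
  shows "strict_mono (inv g)"
  by (rule strict_monoI)
    (metis assms bij_inv_eq_iff strict_mono_less)

text \<open>A monotone function with open image cannot jump. Continuity serves the intermediate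
  value theorem for the total injection and the limit in the control law.\<close>

lemma continuous_inv_bij_strict_mono:
  fixes g :: "real \<Rightarrow> real"
  assumes "strict_mono g" "bij g"
  shows "continuous_on UNIV (inv g)"
proof (rule continuous_onI_mono)
  have "inv g ` UNIV = UNIV"
    using assms(2) by (simp add: bij_imp_bij_inv bij_is_surj)
  then show "open (inv g ` UNIV)" by simp
  show "inv g x \<le> inv g y" if "x \<le> y" for x y
    using strict_mono_less_eq[OF strict_mono_inv_bij[OF assms]] that by blast
qed

lemma inv_strict_mono_zero_sgn:
  fixes g :: "real \<Rightarrow> real"
  assumes "strict_mono g" "bij g" "g 0 = 0"
  shows "sgn (inv g x) = sgn x"
proof -
  have "inv g 0 = 0"
    using assms(2,3) by (metis bij_inv_eq_iff)
  then show ?thesis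
    using strict_mono_less[OF strict_mono_inv_bij[OF assms(1,2)], of 0 x]
      strict_mono_less[OF strict_mono_inv_bij[OF assms(1,2)], of x 0]
    by (auto simp: sgn_real_def)
qed

text \<open>Intermediate value theorem for the total response \<open>F\<close> to a common price
  \<open>c\<close>. At the price at which one bus alone would supply \<open>s\<close>, the other
  buses respond with the same sign, so \<open>F\<close> lies at or beyond \<open>s\<close>. All
  responses share the sign of \<open>c\<close>, so no cancellation occurs in the sum.\<close>

lemma common_marginal_cost_exists:
  fixes g :: "'v::finite \<Rightarrow> real \<Rightarrow> real"
  assumes mono: "\<And>j. strict_mono (g j)" and bij: "\<And>j. bij (g j)" and zero: "\<And>j. g j 0 = 0"
  obtains c where "(\<Sum>j\<in>UNIV. inv (g j) c) = s" "(\<Sum>j\<in>UNIV. \<bar>inv (g j) c\<bar>) = \<bar>s\<bar>"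
proof -
  define F where "F c = (\<Sum>j\<in>UNIV. inv (g j) c)" for c
  fix i :: 'v
  note sgn = inv_strict_mono_zero_sgn[OF mono bij zero]
  have nonneg: "inv (g j) c \<ge> 0" if "c \<ge> 0" for j c
    using sgn[of j c] that by (metis zero_le_sgn_iff)
  have nonpos: "inv (g j) c \<le> 0" if "c \<le> 0" for j c
    using sgn[of j c] that by (metis sgn_le_0_iff)
  have cont: "continuous_on A F" for A
    unfolding F_def
    by (intro continuous_intros continuous_on_subset[OF continuous_inv_bij_strict_mono[OF mono bij]])
      auto
  have F0: "F 0 = 0"
    unfolding F_def using nonneg[of 0] nonpos[of 0] by (intro sum.neutral ballI antisym) auto
  have inv_i: "inv (g i) (g i s) = s"
    using bij[of i] by (simp add: bij_is_inj)
  have split: "F c = inv (g i) c + (\<Sum>j\<in>UNIV - {i}. inv (g j) c)" for c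
    unfolding F_def by (rule sum.remove) auto
  have "\<exists>c. F c = s"
  proof (cases "s \<ge> 0")
    case True
    then have "g i s \<ge> 0"
      using strict_mono_less_eq[OF mono, of i 0 s] zero by simp
    moreover have "s \<le> F (g i s)"
      unfolding split inv_i using nonneg[OF calculation] by (simp add: sum_nonneg)
    ultimately show ?thesis
      using IVT'[of F 0 s "g i s"] True F0 cont by auto
  next
    case False
    then have "g i s \<le> 0"
      using strict_mono_less_eq[OF mono, of i s 0] zero by simp
    moreover have "F (g i s) \<le> s"
      unfolding split inv_i using nonpos[OF calculation] by (simp add: sum_nonpos)
    ultimately show ?thesis
      using IVT'[of F "g i s" s 0] False F0 cont by auto
  qed
  then obtain c where c: "F c = s" by blast
  have "(\<Sum>j\<in>UNIV. \<bar>inv (g j) c\<bar>) = \<bar>F c\<bar>"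
  proof (cases "c \<ge> 0")
    case True
    then show ?thesis unfolding F_def using nonneg by (simp add: sum_nonneg)
  next
    case False
    then have "inv (g j) c \<le> 0" for j using nonpos by simp
    then show ?thesis unfolding F_def by (simp add: sum_nonpos sum_negf)
  qed
  then show ?thesis using that c unfolding F_def by blast
qed

section \<open>Network flows\<close>

lemma net_outflow_diff:
  "net_outflow B (\<lambda>i. x i - y i) j = net_outflow B x j - net_outflow B y j"
  unfolding net_outflow_def by (simp add: sum_subtractf[symmetric] algebra_simps)

lemma net_outflow_minus: "net_outflow B (\<lambda>i. - x i) j = - net_outflow B x j"
  unfolding net_outflow_def by (simp add: sum_negf[symmetric] algebra_simps)

lemma net_outflow_diff_const: "net_outflow B (\<lambda>i. x i - c) j = net_outflow B x j"
  unfolding net_outflow_def by simp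

text \<open>Discrete Green identity: exchanging \<open>j\<close> and \<open>k\<close> turns the sum
  weighted by \<open>y k\<close> into minus the one weighted by \<open>y j\<close>. For
  \<open>y = x\<close> it gives the energy of \<open>x\<close>, for \<open>y = 1\<close> the
  conservation of flow.\<close>

lemma sum_mult_net_outflow:
  fixes B :: "'v::finite \<Rightarrow> 'v \<Rightarrow> real"
  assumes "\<And>j k. B j k = B k j"
  shows "(\<Sum>j\<in>UNIV. y j * net_outflow B x j) =
    (\<Sum>j\<in>UNIV. \<Sum>k\<in>UNIV. B j k * (x j - x k) * (y j - y k)) / 2"
proof -
  let ?S = "\<Sum>j\<in>UNIV. \<Sum>k\<in>UNIV. B j k * (x j - x k) * y j"
  let ?T = "\<Sum>j\<in>UNIV. \<Sum>k\<in>UNIV. B j k * (x j - x k) * y k"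
  have "?T = (\<Sum>k\<in>UNIV. \<Sum>j\<in>UNIV. B j k * (x j - x k) * y k)"
    by (rule sum.swap)
  also have "\<dots> = (\<Sum>k\<in>UNIV. \<Sum>j\<in>UNIV. - (B k j * (x k - x j) * y k))"
    by (intro sum.cong refl) (subst assms, simp add: algebra_simps)
  finally have "?T = - ?S" by (simp add: sum_negf)
  moreover have "(\<Sum>j\<in>UNIV. y j * net_outflow B x j) = ?S"
    unfolding net_outflow_def by (simp add: sum_distrib_left algebra_simps)
  moreover have "(\<Sum>j\<in>UNIV. \<Sum>k\<in>UNIV. B j k * (x j - x k) * (y j - y k)) = ?S - ?T"
    by (simp add: sum_subtractf[symmetric] algebra_simps)
  ultimately show ?thesis by simp
qed

lemma sum_net_outflow:
  fixes B :: "'v::finite \<Rightarrow> 'v \<Rightarrow> real"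
  assumes "\<And>j k. B j k = B k j"
  shows "(\<Sum>j\<in>UNIV. net_outflow B x j) = 0"
  using sum_mult_net_outflow[OF assms, where y = "\<lambda>_. 1"] by simp

text \<open>The energy is a sum of nonnegative terms, so each vanishes; hence \<open>x\<close>
  agrees at the ends of every line, and then along every path.\<close>

lemma zero_energy_imp_const:
  fixes E :: "('v::finite \<times> 'v) set"
  assumes "connected_simple_graph E" "line_susceptances E B"
    and zero: "(\<Sum>j\<in>UNIV. x j * net_outflow B x j) = 0"
  shows "x i = x j"
proof -
  have nonneg: "B j k * (x j - x k) * (x j - x k) \<ge> 0" for j k
  proof -
    have "B j k \<ge> 0"
      using assms(2) unfolding line_susceptances_def by (metis less_imp_le order_refl)
    then show ?thesis by (simp add: mult.assoc)
  qed
  have "(\<Sum>j\<in>UNIV. \<Sum>k\<in>UNIV. B j k * (x j - x k) * (x j - x k)) = 0"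
    using zero sum_mult_net_outflow[of B x x] assms(2) unfolding line_susceptances_def by simp
  then have *: "B j k * (x j - x k) * (x j - x k) = 0" for j k
    by (simp add: sum_nonneg_eq_0_iff sum_nonneg nonneg)
  have edge: "x j = x k" if "(j, k) \<in> E" for j k
    using *[of j k] that assms(2) unfolding line_susceptances_def
    by (metis eq_iff_diff_eq_0 less_irrefl mult_eq_0_iff)
  have "(i, j) \<in> E\<^sup>*"
    using assms(1) by (simp add: connected_simple_graph_def)
  then show ?thesis
    by (induction rule: rtrancl_induct) (auto dest: edge)
qed

text \<open>
  Adding the rank-one map \<open>x \<mapsto> (\<Sum>x) 1\<close> to the weighted Laplacian makes it injective, hence
  surjective, without changing its values on vectors of sum zero.
\<close>

lemma net_outflow_surj:
  fixes E :: "('v::finite \<times> 'v) set"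
  assumes graph: "connected_simple_graph E" and B: "line_susceptances E B"
    and w: "(\<Sum>j\<in>UNIV. w j) = 0"
  obtains x where "\<And>j. net_outflow B x j = w j"
proof -
  have sym: "\<And>j k. B j k = B k j"
    using B by (simp add: line_susceptances_def)
  define T :: "real^'v \<Rightarrow> real^'v" where
    "T x = (\<chi> j. net_outflow B (($) x) j + (\<Sum>i\<in>UNIV. x $ i))" for x
  \<comment> \<open>Outflows cancel in the sum, so only the rank-one part remains. Hence a preimage
    of a vector of sum zero has sum zero itself, and there \<open>T\<close> is the weighted
    Laplacian.\<close>
  have sumT: "(\<Sum>j\<in>UNIV. T x $ j) = real CARD('v) * (\<Sum>i\<in>UNIV. x $ i)" for x
    using sum_net_outflow[OF sym] by (simp add: T_def sum.distrib)
  have "linear T"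
    by (rule linearI)
      (auto simp: T_def vec_eq_iff net_outflow_def sum.distrib[symmetric] sum_distrib_left
        algebra_simps)
  moreover have "inj T"
    unfolding linear_injective_0[OF \<open>linear T\<close>]
  proof (intro allI impI)
    fix x assume "T x = 0"
    then have sum0: "(\<Sum>i\<in>UNIV. x $ i) = 0"
      using sumT[of x] by simp
    then have "net_outflow B (($) x) j = 0" for j
      using \<open>T x = 0\<close> by (simp add: T_def vec_eq_iff)
    then have const: "x $ i = x $ j" for i j
      by (intro zero_energy_imp_const[OF graph B]) simp
    have "x $ i = 0" for i
    proof -
      have "(\<Sum>j\<in>UNIV. x $ j) = real CARD('v) * x $ i"
        using const[of _ i] by (subst sum.cong[OF refl, of _ _ "\<lambda>_. x $ i"]) auto
      then show ?thesis using sum0 by simp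
    qed
    then show "x = 0" by (simp add: vec_eq_iff)
  qed
  ultimately have "surj T"
    by (rule linear_inj_imp_surj)
  then obtain x where x: "T x = (\<chi> j. w j)"
    by (metis surjD)
  then have "(\<Sum>i\<in>UNIV. x $ i) = 0"
    using sumT[of x] w by simp
  then have "net_outflow B (($) x) j = w j" for j
    using x by (simp add: T_def vec_eq_iff)
  then show ?thesis using that by blast
qed

text \<open>Minimum principle: where \<open>x\<close> is smallest no flow leaves on balance, so
  \<open>d i \<ge> 0\<close> forces \<open>u i \<le> 0\<close>, and the opposite signs of
  \<open>u\<close> and \<open>x\<close> make the minimum nonnegative.\<close>

lemma injection_response_nonneg:
  fixes B :: "'v::finite \<Rightarrow> 'v \<Rightarrow> real"
  assumes B: "\<And>j k. B j k \<ge> 0" and d: "\<And>j. d j \<ge> 0"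
    and flow: "\<And>j. d j + u j = net_outflow B x j"
    and sgn: "\<And>j. sgn (u j) = - sgn (x j)"
  shows "x j \<ge> 0"
proof -
  define m where "m = Min (range x)"
  have "m \<in> range x" unfolding m_def by (rule Min_in) auto
  then obtain i where i: "x i = m" by auto
  have min: "x i \<le> x j" for j unfolding i m_def by simp
  have "net_outflow B x i \<le> 0"
    unfolding net_outflow_def using B min by (intro sum_nonpos) (simp add: mult_le_0_iff)
  then have "u i \<le> 0" using flow[of i] d[of i] by linarith
  then have "x i \<ge> 0" using sgn[of i] by (auto simp: sgn_if split: if_splits)
  then show ?thesis using min[of j] by linarith
qed

text \<open>Conservation of flow fixes the sum of \<open>u\<close>. Since \<open>x\<close>, and with
  it \<open>u\<close>, has constant sign, the sum of absolute values is the absolute value of the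
  sum.\<close>

lemma injection_response_sum_abs:
  fixes B :: "'v::finite \<Rightarrow> 'v \<Rightarrow> real"
  assumes sym: "\<And>j k. B j k = B k j" and B: "\<And>j k. B j k \<ge> 0"
    and flow: "\<And>j. (if j = k then \<Delta> else 0) + u j = net_outflow B x j"
    and sgn: "\<And>j. sgn (u j) = - sgn (x j)"
  shows "(\<Sum>j\<in>UNIV. u j) = - \<Delta>" "(\<Sum>j\<in>UNIV. \<bar>u j\<bar>) = \<bar>\<Delta>\<bar>"
proof -
  have "(\<Sum>j\<in>UNIV. (if j = k then \<Delta> else 0) + u j) = 0"
    unfolding flow using sym by (rule sum_net_outflow)
  then show sum: "(\<Sum>j\<in>UNIV. u j) = - \<Delta>" by (simp add: sum.distrib)
  show "(\<Sum>j\<in>UNIV. \<bar>u j\<bar>) = \<bar>\<Delta>\<bar>"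
  proof (cases "\<Delta> \<ge> 0")
    case True
    have "x j \<ge> 0" for j
      by (rule injection_response_nonneg[OF B _ flow sgn]) (simp add: True)
    then have "u j \<le> 0" for j
      using sgn[of j] by (metis neg_le_0_iff_le sgn_le_0_iff zero_le_sgn_iff)
    then show ?thesis using sum True by (simp add: sum_negf)
  next
    case False
    \<comment> \<open>The system is linear and the sign condition is odd, so the minimum principle
      applies to \<open>- x\<close>, \<open>- u\<close> and \<open>- \<Delta>\<close>.\<close>
    have "- x j \<ge> 0" for j
    proof (rule injection_response_nonneg[OF B])
      show "(if j = k then - \<Delta> else 0) \<ge> 0" for j using False by simp
      show "(if j = k then - \<Delta> else 0) + - u j = net_outflow B (\<lambda>i. - x i) j" for j
        using flow[of j] by (auto simp: net_outflow_minus)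
      show "sgn (- u j) = - sgn (- x j)" for j
        using sgn[of j] by (simp add: sgn_minus)
    qed
    then have "x j \<le> 0" for j by simp
    then have "u j \<ge> 0" for j
      using sgn[of j] by (metis neg_0_le_iff_le sgn_le_0_iff zero_le_sgn_iff)
    then show ?thesis using sum False by simp
  qed
qed

section \<open>Algebraic connectivity\<close>

text \<open>The unweighted Laplacian is the outflow map for unit susceptances, so the flow lemmas
  apply to it. Irreflexivity leaves only the degree on the diagonal.\<close>

lemma graph_laplacian_mult:
  assumes "irrefl E"
  shows "graph_laplacian E *v x =
    (\<chi> j. net_outflow (\<lambda>j k. of_bool ((j, k) \<in> E)) (($) x) j)"
proof -
  have "(graph_laplacian E *v x) $ j = net_outflow (\<lambda>j k. of_bool ((j, k) \<in> E)) (($) x) j" for j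
  proof -
    have "(graph_laplacian E *v x) $ j =
        (\<Sum>k\<in>UNIV. (if j = k then real (card (E `` {j})) * x $ j else 0) - of_bool ((j, k) \<in> E) * x $ k)"
      using assms unfolding graph_laplacian_def matrix_vector_mult_def
      by (auto simp: irrefl_def intro!: sum.cong)
    also have "\<dots> = real (card (E `` {j})) * x $ j - (\<Sum>k\<in>UNIV. of_bool ((j, k) \<in> E) * x $ k)"
      by (simp add: sum_subtractf)
    also have "real (card (E `` {j})) = (\<Sum>k\<in>UNIV. of_bool ((j, k) \<in> E))"
    proof -
      have "E `` {j} = {k. (j, k) \<in> E}" by auto
      then show ?thesis by simp
    qed
    finally show ?thesis
      unfolding net_outflow_def by (simp add: sum_distrib_right right_diff_distrib sum_subtractf)
  qed
  then show ?thesis by (simp add: vec_eq_iff)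
qed

text \<open>The quadratic form attains its minimum on the compact unit sphere of \<open>S\<close>.
  Invariance of \<open>S\<close> keeps the residual \<open>z = A *v x - \<mu> *\<^sub>R x\<close> in
  \<open>S\<close>, so \<open>z\<close> is an admissible direction of variation and has to
  vanish.\<close>

lemma rayleigh_minimizer:
  fixes A :: "real^'v^'v::finite"
  assumes S: "subspace S" "S \<noteq> {0}" and inv: "\<And>x. x \<in> S \<Longrightarrow> A *v x \<in> S"
    and sym: "\<And>x y. x \<bullet> (A *v y) = y \<bullet> (A *v x)"
  obtains x \<mu> where "x \<in> S" "x \<noteq> 0" "A *v x = \<mu> *\<^sub>R x"
    "\<And>y. y \<in> S \<Longrightarrow> \<mu> * (y \<bullet> y) \<le> y \<bullet> (A *v y)"
proof -
  let ?K = "S \<inter> sphere 0 1"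
  obtain a where "a \<in> S" "a \<noteq> 0"
    using S subspace_0 by blast
  then have "a /\<^sub>R norm a \<in> ?K"
    using S(1) by (simp add: subspace_scale)
  then have "?K \<noteq> {}" by blast
  moreover have "compact ?K"
    using S(1) by (simp add: closed_Int_compact closed_subspace)
  moreover have "continuous_on ?K (\<lambda>x. x \<bullet> (A *v x))"
    by (intro continuous_intros linear_continuous_on_compose[OF continuous_on_id]) simp
  ultimately obtain x where x: "x \<in> ?K" and min: "\<And>y. y \<in> ?K \<Longrightarrow> x \<bullet> (A *v x) \<le> y \<bullet> (A *v y)"
    using continuous_attains_inf[of ?K "\<lambda>x. x \<bullet> (A *v x)"] by blast
  define \<mu> where "\<mu> = x \<bullet> (A *v x)"
  have xx: "x \<bullet> x = 1" using x by (simp add: norm_eq_1)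
  have bound: "\<mu> * (y \<bullet> y) \<le> y \<bullet> (A *v y)" if "y \<in> S" for y
  proof (cases "y = 0")
    case False
    have "y /\<^sub>R norm y \<in> ?K" using False that S(1) by (simp add: subspace_scale)
    from min[OF this] have "\<mu> \<le> (y \<bullet> (A *v y)) / (norm y)\<^sup>2"
      by (simp add: \<mu>_def matrix_vector_mult_scaleR power2_eq_square divide_inverse ac_simps)
    then show ?thesis
      using False by (simp add: dot_square_norm field_simps)
  qed simp
  define z where "z = A *v x - \<mu> *\<^sub>R x"
  have "z \<in> S" unfolding z_def using x S(1) inv by (simp add: subspace_diff subspace_scale)
  \<comment> \<open>First variation of the Rayleigh quotient at \<open>x\<close> in the direction \<open>z\<close>.\<close>
  have var: "0 \<le> 2 * t * (z \<bullet> z) + t\<^sup>2 * (z \<bullet> (A *v z) - \<mu> * (z \<bullet> z))" for t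
  proof -
    have "x + t *\<^sub>R z \<in> S"
      using x \<open>z \<in> S\<close> S(1) by (simp add: subspace_add subspace_scale)
    from bound[OF this]
    have "0 \<le> (x + t *\<^sub>R z) \<bullet> (A *v (x + t *\<^sub>R z)) - \<mu> * ((x + t *\<^sub>R z) \<bullet> (x + t *\<^sub>R z))"
      by simp
    also have "\<dots> = 2 * t * (z \<bullet> (A *v x) - \<mu> * (z \<bullet> x)) + t\<^sup>2 * (z \<bullet> (A *v z) - \<mu> * (z \<bullet> z))"
      using sym[of x z] xx
      by (simp add: matrix_vector_right_distrib matrix_vector_mult_scaleR inner_add_left
          inner_add_right \<mu>_def[symmetric] inner_commute[of z x] power2_eq_square algebra_simps)
    also have "z \<bullet> (A *v x) - \<mu> * (z \<bullet> x) = z \<bullet> z"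
      unfolding z_def by (simp add: inner_diff_right)
    finally show ?thesis .
  qed
  have "z \<bullet> z = 0"
  proof (rule ccontr)
    assume "z \<bullet> z \<noteq> 0"
    then have pos: "z \<bullet> z > 0" by simp
    \<comment> \<open>\<open>q\<close> is a positive bound for the quadratic coefficient, and the
      \<open>t\<close> below minimises the parabola
      \<open>2 * t * (z \<bullet> z) + t\<^sup>2 * q\<close>, whose minimum is negative.\<close>
    define q where "q = \<bar>z \<bullet> (A *v z) - \<mu> * (z \<bullet> z)\<bar> + 1"
    have "q > 0" by (simp add: q_def)
    define t where "t = - (z \<bullet> z) / q"
    have "0 \<le> 2 * t * (z \<bullet> z) + t\<^sup>2 * (z \<bullet> (A *v z) - \<mu> * (z \<bullet> z))" by (rule var)
    also have "\<dots> \<le> 2 * t * (z \<bullet> z) + t\<^sup>2 * q"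
      by (intro add_left_mono mult_left_mono) (auto simp: q_def)
    also have "\<dots> = - (z \<bullet> z)\<^sup>2 / q"
      using \<open>q > 0\<close> by (simp add: t_def field_simps power2_eq_square)
    also have "\<dots> < 0" using pos \<open>q > 0\<close> by simp
    finally show False by simp
  qed
  then have "A *v x = \<mu> *\<^sub>R x" by (simp add: z_def)
  moreover have "x \<noteq> 0" using xx by auto
  ultimately show ?thesis using that x bound by blast
qed

text \<open>Eigenvectors for distinct eigenvalues are orthogonal, hence independent. Without
  finiteness the sum defining \<open>eigenvalue_mset\<close> would fall back to the empty
  multiset.\<close>

lemma finite_eigenvalues_symmetric:
  fixes A :: "real^'v^'v::finite"
  assumes sym: "\<And>x y. x \<bullet> (A *v y) = y \<bullet> (A *v x)"
  shows "finite (eigenvalues A)"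
proof -
  define e where "e \<mu> = (SOME x. x \<noteq> 0 \<and> A *v x = \<mu> *\<^sub>R x)" for \<mu>
  have e: "e \<mu> \<noteq> 0" "A *v e \<mu> = \<mu> *\<^sub>R e \<mu>" if "\<mu> \<in> eigenvalues A" for \<mu>
    using someI_ex[of "\<lambda>x. x \<noteq> 0 \<and> A *v x = \<mu> *\<^sub>R x"] that
    unfolding eigenvalues_def e_def by blast+
  have orth: "e \<mu> \<bullet> e \<nu> = 0" if "\<mu> \<in> eigenvalues A" "\<nu> \<in> eigenvalues A" "\<mu> \<noteq> \<nu>" for \<mu> \<nu>
    using sym[of "e \<mu>" "e \<nu>"] e that by (simp add: inner_commute)
  have "inj_on e (eigenvalues A)"
    by (rule inj_onI) (metis e(1) inner_eq_zero_iff orth)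
  moreover have "independent (e ` eigenvalues A)"
    using e(1) by (intro pairwise_orthogonal_independent)
      (auto simp: pairwise_def orthogonal_def intro!: orth)
  ultimately show ?thesis
    using independent_imp_finite finite_imageD by blast
qed

section \<open>Multiplicities and the second smallest eigenvalue\<close>

lemma count_eigenvalue_mset:
  assumes "finite (eigenvalues A)"
  shows "count (eigenvalue_mset A) \<mu> = (if \<mu> \<in> eigenvalues A then dim (eigenspace A \<mu>) else 0)"
  using assms unfolding eigenvalue_mset_def by (simp add: count_sum)

lemma eigenvalue_dim_eigenspace_pos:
  assumes "\<mu> \<in> eigenvalues A"
  shows "dim (eigenspace A \<mu>) > 0"
proof -
  obtain x where "x \<in> eigenspace A \<mu>" "x \<noteq> 0"
    using assms unfolding eigenvalues_def eigenspace_def by blast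
  then have "\<not> eigenspace A \<mu> \<subseteq> {0}" by blast
  then show ?thesis by (metis dim_eq_0 gr0I)
qed

text \<open>The least element \<open>a\<close> occurs only at position 0, so everything behind it is
  larger, and \<open>b\<close> is in the tail that position 1 heads. It will be used with
  \<open>a = 0\<close> and \<open>b\<close> the least Rayleigh quotient on vectors of sum
  zero.\<close>

lemma sorted_second_element:
  fixes xs :: "'a::linorder list"
  assumes "sorted xs" "count (mset xs) a = 1" "\<And>x. x \<in> set xs \<Longrightarrow> a \<le> x" "b \<in> set xs" "b \<noteq> a"
  shows "a < xs ! 1" "xs ! 1 \<le> b"
proof -
  have "a \<in> set xs"
    using assms(2) by (metis count_mset_0_iff zero_neq_one)
  then obtain ys where xs: "xs = a # ys"
    using assms(1,3) by (cases xs) (auto intro: antisym)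
  then have "a \<notin> set ys"
    using assms(2) by (simp add: count_mset_0_iff)
  moreover obtain z zs where ys: "ys = z # zs"
    using assms(4,5) xs by (cases ys) auto
  ultimately show "a < xs ! 1" "xs ! 1 \<le> b"
    using assms xs by (auto simp: order.strict_iff_order)
qed

text \<open>Connectedness makes the eigenvalue 0 simple, so the second list entry is positive. It is
  at most the minimum \<open>\<mu>\<close> of the Rayleigh quotient on vectors of sum zero, because
  \<open>\<mu>\<close> is a nonzero eigenvalue; this direction yields the Poincare
  inequality.\<close>

lemma algebraic_connectivity_poincare:
  fixes E :: "('v::finite \<times> 'v) set"
  assumes two: "CARD('v) \<ge> 2" and graph: "connected_simple_graph E"
  shows "algebraic_connectivity E > 0"
    and "(\<Sum>j\<in>UNIV. y j) = 0 \<Longrightarrow>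
      algebraic_connectivity E * (\<Sum>j\<in>UNIV. (y j)\<^sup>2) \<le>
      (\<Sum>j\<in>UNIV. y j * net_outflow (\<lambda>j k. of_bool ((j, k) \<in> E)) y j)"
proof -
  let ?B = "\<lambda>j k. of_bool ((j, k) \<in> E) :: real" and ?L = "graph_laplacian E"
  let ?one = "(\<chi> i. 1) :: real^'v"
  have symB: "?B j k = ?B k j" for j k
    using graph by (auto simp: connected_simple_graph_def sym_def)
  have B: "line_susceptances E ?B"
    using symB by (simp add: line_susceptances_def)
  have L: "?L *v x = (\<chi> j. net_outflow ?B (($) x) j)" for x
    using graph by (intro graph_laplacian_mult) (simp add: connected_simple_graph_def)
  have quad: "x \<bullet> (?L *v y) = (\<Sum>j\<in>UNIV. x $ j * net_outflow ?B (($) y) j)" for x y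
    by (simp add: L inner_vec_def)
  have sym: "x \<bullet> (?L *v y) = y \<bullet> (?L *v x)" for x y
    unfolding quad sum_mult_net_outflow[of ?B, OF symB] by (simp add: ac_simps)
  have nonneg: "x \<bullet> (?L *v x) \<ge> 0" for x
    unfolding quad sum_mult_net_outflow[of ?B, OF symB] by (auto intro!: sum_nonneg)
  have const: "x $ i = x $ j" if "x \<bullet> (?L *v x) = 0" for x i j
    using zero_energy_imp_const[OF graph B, of "($) x"] that by (simp add: quad)
  have fin: "finite (eigenvalues ?L)"
    by (rule finite_eigenvalues_symmetric[OF sym])
  have eig_nonneg: "\<mu> \<ge> 0" if \<mu>: "\<mu> \<in> eigenvalues ?L" for \<mu>
  proof -
    obtain x where "x \<noteq> 0" "?L *v x = \<mu> *\<^sub>R x"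
      using \<mu> by (auto simp: eigenvalues_def)
    then show ?thesis
      using nonneg[of x] inner_gt_zero_iff[of x] by (simp add: zero_le_mult_iff not_le[symmetric])
  qed
  have "?one \<noteq> 0" by (simp add: vec_eq_iff)
  have "?L *v ?one = 0" by (simp add: L net_outflow_def vec_eq_iff)
  then have zero: "0 \<in> eigenvalues ?L"
    using \<open>?one \<noteq> 0\<close> by (auto simp: eigenvalues_def)
  \<comment> \<open>A kernel vector has zero energy and is therefore constant, so 0 has multiplicity
    one.\<close>
  have "eigenspace ?L 0 = span {?one}"
  proof (intro set_eqI iffI)
    fix x assume "x \<in> eigenspace ?L 0"
    then have "x \<bullet> (?L *v x) = 0" by (simp add: eigenspace_def)
    then have "x = (x $ undefined) *\<^sub>R ?one"
      by (auto simp: vec_eq_iff intro: const)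
    then show "x \<in> span {?one}" by (metis span_base span_scale singletonI)
  next
    fix x assume "x \<in> span {?one}"
    then obtain c where "x = c *\<^sub>R ?one" by (auto simp: span_singleton)
    then show "x \<in> eigenspace ?L 0"
      using \<open>?L *v ?one = 0\<close> by (simp add: eigenspace_def matrix_vector_mult_scaleR)
  qed
  then have "count (eigenvalue_mset ?L) 0 = 1"
    using zero \<open>?one \<noteq> 0\<close> by (simp add: count_eigenvalue_mset[OF fin])
  define S where "S = {x :: real^'v. ?one \<bullet> x = 0}"
  have S: "x \<in> S \<longleftrightarrow> (\<Sum>j\<in>UNIV. x $ j) = 0" for x
    by (simp add: S_def inner_vec_def)
  \<comment> \<open>Two distinct buses give a nonzero vector of sum zero, as the Rayleigh argument
    on \<open>S\<close> requires.\<close>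
  obtain a b :: 'v where "a \<noteq> b"
    using two by (metis card_le_Suc0_iff_eq finite_code not_less_eq_eq numeral_2_eq_2)
  then have "axis a 1 - axis b 1 \<in> S" "axis a 1 - axis b 1 \<noteq> (0 :: real^'v)"
    by (auto simp: S_def inner_diff_right inner_axis axis_eq_axis)
  then have "S \<noteq> {0}" by blast
  moreover have "subspace S" unfolding S_def by (rule subspace_hyperplane)
  moreover have "?L *v x \<in> S" for x
    using sum_net_outflow[of ?B, OF symB] by (simp add: S L)
  ultimately obtain x \<mu> where x: "x \<in> S" "x \<noteq> 0" "?L *v x = \<mu> *\<^sub>R x"
    and min: "\<And>y. y \<in> S \<Longrightarrow> \<mu> * (y \<bullet> y) \<le> y \<bullet> (?L *v y)"
    using rayleigh_minimizer[of S ?L] sym by blast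
  have \<mu>: "\<mu> \<in> eigenvalues ?L" using x by (auto simp: eigenvalues_def)
  \<comment> \<open>A constant vector of sum zero is zero, so no eigenvector in \<open>S\<close>
    belongs to 0.\<close>
  have "\<mu> \<noteq> 0"
  proof
    assume "\<mu> = 0"
    then have c: "x $ i = x $ j" for i j using x(3) by (intro const) simp
    have "x $ i = 0" for i
    proof -
      have "(\<Sum>j\<in>UNIV. x $ j) = (\<Sum>j\<in>(UNIV :: 'v set). x $ i)"
        by (intro sum.cong refl c)
      then show ?thesis using x(1) by (simp add: S)
    qed
    then show False using x(2) by (simp add: vec_eq_iff)
  qed
  let ?xs = "sorted_list_of_multiset (eigenvalue_mset ?L)"
  have set_xs: "\<nu> \<in> set ?xs \<longleftrightarrow> \<nu> \<in> eigenvalues ?L" for \<nu>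
    using count_eigenvalue_mset[OF fin, of \<nu>] eigenvalue_dim_eigenspace_pos[of \<nu> ?L]
    by (auto simp: count_greater_zero_iff[symmetric] simp del: count_greater_zero_iff)
  have second: "0 < ?xs ! 1" "?xs ! 1 \<le> \<mu>"
    using sorted_second_element[of ?xs 0 \<mu>, unfolded set_xs] \<open>count _ 0 = 1\<close> \<mu> \<open>\<mu> \<noteq> 0\<close> eig_nonneg
    by simp_all
  then show "algebraic_connectivity E > 0"
    by (simp add: algebraic_connectivity_def)
  show "algebraic_connectivity E * (\<Sum>j\<in>UNIV. (y j)\<^sup>2) \<le>
      (\<Sum>j\<in>UNIV. y j * net_outflow ?B y j)" if "(\<Sum>j\<in>UNIV. y j) = 0"
  proof -
    have "algebraic_connectivity E * (\<Sum>j\<in>UNIV. (y j)\<^sup>2) \<le> \<mu> * (\<Sum>j\<in>UNIV. (y j)\<^sup>2)"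
      using second(2) by (intro mult_right_mono sum_nonneg) (auto simp: algebraic_connectivity_def)
    also have "\<dots> \<le> (\<Sum>j\<in>UNIV. y j * net_outflow ?B y j)"
      using min[of "\<chi> j. y j"] that
      unfolding quad S by (simp add: inner_vec_def power2_eq_square net_outflow_def)
    finally show ?thesis .
  qed
qed

section \<open>Comparison of the weighted with the unweighted energy\<close>

lemma min_susceptance_pos:
  fixes E :: "('v::finite \<times> 'v) set"
  assumes "CARD('v) \<ge> 2" "connected_simple_graph E" "line_susceptances E B"
  shows "min_susceptance E B > 0"
proof -
  obtain a b :: 'v where "a \<noteq> b"
    using assms(1) by (metis card_le_Suc0_iff_eq finite_code not_less_eq_eq numeral_2_eq_2)
  moreover have "(a, b) \<in> E\<^sup>*"
    using assms(2) by (simp add: connected_simple_graph_def)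
  ultimately have "E \<noteq> {}" by auto
  then show ?thesis
    using assms(3) unfolding min_susceptance_def line_susceptances_def by (subst Min_gr_iff) auto
qed

text \<open>Once both energies are sums of weighted squared differences, they compare term by
  term.\<close>

lemma min_susceptance_energy_le:
  fixes E :: "('v::finite \<times> 'v) set"
  assumes "connected_simple_graph E" and B: "line_susceptances E B"
  shows "min_susceptance E B * (\<Sum>j\<in>UNIV. x j * net_outflow (\<lambda>j k. of_bool ((j, k) \<in> E)) x j) \<le>
    (\<Sum>j\<in>UNIV. x j * net_outflow B x j)"
proof -
  have symB: "B j k = B k j" for j k
    using B by (simp add: line_susceptances_def)
  have symE: "(of_bool ((j, k) \<in> E) :: real) = of_bool ((k, j) \<in> E)" for j k
    using assms(1) by (auto simp: connected_simple_graph_def sym_def)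
  have "min_susceptance E B * of_bool ((j, k) \<in> E) \<le> B j k" for j k
    using B unfolding min_susceptance_def line_susceptances_def by (force intro: Min_le)
  then have "min_susceptance E B * of_bool ((j, k) \<in> E) * (x j - x k)\<^sup>2 \<le> B j k * (x j - x k)\<^sup>2" for j k
    by (rule mult_right_mono) simp
  then have "(\<Sum>j\<in>UNIV. \<Sum>k\<in>UNIV. min_susceptance E B * of_bool ((j, k) \<in> E) * (x j - x k)\<^sup>2)
    \<le> (\<Sum>j\<in>UNIV. \<Sum>k\<in>UNIV. B j k * (x j - x k)\<^sup>2)"
    by (intro sum_mono)
  then show ?thesis
    unfolding sum_mult_net_outflow[of B, OF symB]
      sum_mult_net_outflow[of "\<lambda>j k. of_bool ((j, k) \<in> E)", OF symE]
    by (simp add: sum_distrib_left power2_eq_square mult.assoc del: sum_mult_of_bool_eq sum_of_bool_mult_eq)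
qed

section \<open>Cost of the steady state\<close>

text \<open>Tangent inequalities bound the gap by marginal cost times displacement, and equal totals
  allow any constant \<open>c\<close> to be subtracted from the marginal costs. With
  \<open>R = 0\<close> this proves optimality of equal marginal costs; with \<open>R > 0\<close> it
  measures the loss from unequal ones.\<close>

lemma total_cost_diff_le:
  fixes f :: "'v::finite \<Rightarrow> real \<Rightarrow> real"
  assumes convex: "\<And>j. convex_on UNIV (f j)" and diff: "\<And>j. f j differentiable_on UNIV"
    and sum: "(\<Sum>j\<in>UNIV. u j) = (\<Sum>j\<in>UNIV. w j)"
    and spread: "\<And>j. \<bar>deriv (f j) (u j) - c\<bar> \<le> R"
  shows "total_cost f u - total_cost f w \<le> R * (\<Sum>j\<in>UNIV. \<bar>u j - w j\<bar>)"
proof -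
  have "total_cost f u - total_cost f w = (\<Sum>j\<in>UNIV. f j (u j) - f j (w j))"
    by (simp add: total_cost_def sum_subtractf)
  also have "\<dots> \<le> (\<Sum>j\<in>UNIV. deriv (f j) (u j) * (u j - w j))"
  proof (rule sum_mono)
    fix j
    show "f j (u j) - f j (w j) \<le> deriv (f j) (u j) * (u j - w j)"
      using convex_on_deriv_above_tangent[OF convex diff, of j "u j" "w j"]
      by (simp add: algebra_simps)
  qed
  also have "\<dots> = (\<Sum>j\<in>UNIV. (deriv (f j) (u j) - c) * (u j - w j))"
    using sum by (simp add: left_diff_distrib sum_subtractf sum_distrib_left[symmetric])
  also have "\<dots> \<le> (\<Sum>j\<in>UNIV. R * \<bar>u j - w j\<bar>)"
  proof (rule sum_mono)
    fix j
    have "(deriv (f j) (u j) - c) * (u j - w j) \<le> \<bar>deriv (f j) (u j) - c\<bar> * \<bar>u j - w j\<bar>"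
      by (metis abs_ge_self abs_mult)
    also have "\<dots> \<le> R * \<bar>u j - w j\<bar>"
      by (intro mult_right_mono spread) simp
    finally show "(deriv (f j) (u j) - c) * (u j - w j) \<le> R * \<bar>u j - w j\<bar>" .
  qed
  finally show ?thesis by (simp add: sum_distrib_left)
qed

text \<open>A feasible injection is constrained only by its sum: outflows sum to zero, and on a
  connected network every vector of sum zero is an outflow. Injections with equal marginal costs
  \<open>c\<close> and the right sum are therefore optimal, so the \<open>LEAST\<close> is
  attained.\<close>

lemma optimal_cost_attained:
  fixes E :: "('v::finite \<times> 'v) set"
  assumes graph: "connected_simple_graph E" and B: "line_susceptances E B"
    and convex: "\<And>j. convex_on UNIV (f j)" and diff: "\<And>j. f j differentiable_on UNIV"
    and zero: "\<And>j. deriv (f j) 0 = 0" and bij: "\<And>j. bij (deriv (f j))"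
  obtains w where "optimal_cost B p f = total_cost f w" "(\<Sum>j\<in>UNIV. w j) = - (\<Sum>j\<in>UNIV. p j)"
    "(\<Sum>j\<in>UNIV. \<bar>w j\<bar>) = \<bar>\<Sum>j\<in>UNIV. p j\<bar>"
proof -
  have mono: "strict_mono (deriv (f j))" for j
    by (rule convex_on_deriv_strict_mono[OF convex diff bij_is_inj[OF bij]])
  obtain c where c: "(\<Sum>j\<in>UNIV. inv (deriv (f j)) c) = - (\<Sum>j\<in>UNIV. p j)"
    "(\<Sum>j\<in>UNIV. \<bar>inv (deriv (f j)) c\<bar>) = \<bar>- (\<Sum>j\<in>UNIV. p j)\<bar>"
    using common_marginal_cost_exists[of "\<lambda>j. deriv (f j)", OF mono bij zero] by blast
  define w where "w j = inv (deriv (f j)) c" for j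
  have marginal: "deriv (f j) (w j) = c" for j
    unfolding w_def using bij by (simp add: bij_is_surj surj_f_inv_f)
  obtain \<psi> where \<psi>: "\<And>j. net_outflow B \<psi> j = p j + w j"
    using net_outflow_surj[OF graph B, of "\<lambda>j. p j + w j"] c by (auto simp: sum.distrib w_def)
  have "optimal_cost B p f = total_cost f w"
    unfolding optimal_cost_def
  proof (rule Least_equality)
    show "\<exists>u \<theta>. power_balanced B p u \<theta> \<and> total_cost f w = total_cost f u"
      using \<psi> by (intro exI[of _ w] exI[of _ \<psi>]) (simp add: power_balanced_def)
    fix y assume "\<exists>u \<theta>. power_balanced B p u \<theta> \<and> y = total_cost f u"
    then obtain u \<theta> where u: "power_balanced B p u \<theta>" and y: "y = total_cost f u" by blast
    have "(\<Sum>j\<in>UNIV. p j + u j) = (\<Sum>j\<in>UNIV. net_outflow B \<theta> j)"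
      using u by (intro sum.cong) (auto simp: power_balanced_def)
    also have "\<dots> = 0"
      using B by (intro sum_net_outflow) (simp add: line_susceptances_def)
    finally have "(\<Sum>j\<in>UNIV. w j) = (\<Sum>j\<in>UNIV. u j)"
      using c(1) by (simp add: sum.distrib w_def)
    then have "total_cost f w - total_cost f u \<le> 0 * (\<Sum>j\<in>UNIV. \<bar>w j - u j\<bar>)"
      using marginal by (intro total_cost_diff_le[OF convex diff, where c = c]) auto
    then show "total_cost f w \<le> y" by (simp add: y)
  qed
  then show ?thesis using that[of w] c by (simp add: w_def)
qed

text \<open>The static core, free of trajectories. Bounding each deviation from the mean by the
  Euclidean norm \<open>r\<close>, and the injections in the sum of absolute values, keeps the
  number of buses out of the estimate.\<close>

lemma steady_state_cost_gap:
  fixes E :: "('v::finite \<times> 'v) set"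
  assumes two: "CARD('v) \<ge> 2" and graph: "connected_simple_graph E" and B: "line_susceptances E B"
    and convex: "\<And>j. convex_on UNIV (f j)" and diff: "\<And>j. f j differentiable_on UNIV"
    and zero: "\<And>j. deriv (f j) 0 = 0" and bij: "\<And>j. bij (deriv (f j))"
    and h: "h > 0"
    and u: "\<And>j. u j = inv (deriv (f j)) (- h * \<phi> j)"
    and flow: "\<And>j. (if j = k then \<Delta> else 0) + u j = net_outflow B \<phi> j"
    and p: "(\<Sum>j\<in>UNIV. p j) = \<Delta>"
  shows "total_cost f u \<le> optimal_cost B p f +
    4 * \<Delta>\<^sup>2 * h / (min_susceptance E B * algebraic_connectivity E)"
proof -
  let ?\<kappa> = "min_susceptance E B * algebraic_connectivity E"
  have \<kappa>: "?\<kappa> > 0"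
    using min_susceptance_pos[OF two graph B] algebraic_connectivity_poincare(1)[OF two graph] by simp
  have symB: "B j k = B k j" and B0: "B j k \<ge> 0" for j k
    using B unfolding line_susceptances_def by (blast, metis less_imp_le order_refl)
  have mono: "strict_mono (deriv (f j))" for j
    by (rule convex_on_deriv_strict_mono[OF convex diff bij_is_inj[OF bij]])
  have sgn: "sgn (u j) = - sgn (\<phi> j)" for j
    unfolding u inv_strict_mono_zero_sgn[OF mono bij zero] using h by (simp add: sgn_mult)
  note u_sum = injection_response_sum_abs[OF symB B0 flow sgn]
  obtain w where w: "optimal_cost B p f = total_cost f w" "(\<Sum>j\<in>UNIV. w j) = - \<Delta>"
    "(\<Sum>j\<in>UNIV. \<bar>w j\<bar>) = \<bar>\<Delta>\<bar>"
    using optimal_cost_attained[OF graph B, of f p, OF convex diff zero bij] p by auto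

  \<comment> \<open>Subtracting the mean leaves the outflow unchanged and makes the Poincare
    inequality applicable.\<close>
  define m where "m = (\<Sum>j\<in>UNIV. \<phi> j) / real CARD('v)"
  define x where "x j = \<phi> j - m" for j
  define r where "r = sqrt (\<Sum>j\<in>UNIV. (x j)\<^sup>2)"
  have r0: "r \<ge> 0" by (simp add: r_def sum_nonneg)
  have abs_x: "\<bar>x j\<bar> \<le> r" for j
  proof -
    have "(x j)\<^sup>2 \<le> (\<Sum>j\<in>UNIV. (x j)\<^sup>2)" by (rule member_le_sum) auto
    then show ?thesis unfolding r_def by (metis real_sqrt_abs real_sqrt_le_mono)
  qed
  have "(\<Sum>j\<in>UNIV. x j) = 0"
    by (simp add: x_def m_def sum_subtractf)
  then have "?\<kappa> * (\<Sum>j\<in>UNIV. (x j)\<^sup>2) \<le>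
      min_susceptance E B * (\<Sum>j\<in>UNIV. x j * net_outflow (\<lambda>j k. of_bool ((j, k) \<in> E)) x j)"
    using algebraic_connectivity_poincare(2)[OF two graph, of x] min_susceptance_pos[OF two graph B]
    by (simp add: mult.assoc)
  also have "\<dots> \<le> (\<Sum>j\<in>UNIV. x j * net_outflow B x j)"
    by (rule min_susceptance_energy_le[OF graph B])
  also have "\<dots> = (\<Sum>j\<in>UNIV. x j * ((if j = k then \<Delta> else 0) + u j))"
    unfolding flow by (simp add: x_def[abs_def] net_outflow_diff_const)
  \<comment> \<open>The perturbation and the response each contribute
    \<open>\<bar>\<Delta>\<bar>\<close> to the sum of absolute values.\<close>
  also have "\<dots> \<le> (\<Sum>j\<in>UNIV. r * ((if j = k then \<bar>\<Delta>\<bar> else 0) + \<bar>u j\<bar>))"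
  proof (rule sum_mono)
    fix j
    have "x j * ((if j = k then \<Delta> else 0) + u j) \<le> \<bar>x j\<bar> * \<bar>(if j = k then \<Delta> else 0) + u j\<bar>"
      by (metis abs_ge_self abs_mult)
    also have "\<dots> \<le> r * ((if j = k then \<bar>\<Delta>\<bar> else 0) + \<bar>u j\<bar>)"
      using r0 by (intro mult_mono abs_x) auto
    finally show "x j * ((if j = k then \<Delta> else 0) + u j) \<le>
      r * ((if j = k then \<bar>\<Delta>\<bar> else 0) + \<bar>u j\<bar>)" .
  qed
  also have "\<dots> = r * (2 * \<bar>\<Delta>\<bar>)"
    using u_sum(2) by (simp add: sum_distrib_left[symmetric] sum.distrib)
  finally have "?\<kappa> * r\<^sup>2 \<le> r * (2 * \<bar>\<Delta>\<bar>)"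
    by (simp add: r_def sum_nonneg)
  then have "(?\<kappa> * r) * r \<le> (2 * \<bar>\<Delta>\<bar>) * r"
    by (simp add: power2_eq_square ac_simps)
  then have r: "r \<le> 2 * \<bar>\<Delta>\<bar> / ?\<kappa>"
    using r0 \<kappa> by (cases "r = 0") (auto simp: pos_le_divide_eq mult.commute mult_le_cancel_right)

  have "total_cost f u - total_cost f w \<le> (h * r) * (\<Sum>j\<in>UNIV. \<bar>u j - w j\<bar>)"
  \<comment> \<open>The marginal costs are the prices \<open>- h * \<phi> j\<close>;
    \<open>c\<close> is their mean, so the deviations are \<open>- h * x j\<close>.\<close>
  proof (rule total_cost_diff_le[OF convex diff, where c = "- h * m"])
    show "(\<Sum>j\<in>UNIV. u j) = (\<Sum>j\<in>UNIV. w j)" using u_sum(1) w(2) by simp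
    fix j
    have "deriv (f j) (u j) = - h * \<phi> j"
      unfolding u using bij by (simp add: bij_is_surj surj_f_inv_f)
    then have "deriv (f j) (u j) - - h * m = - (h * x j)"
      by (simp add: x_def algebra_simps)
    then show "\<bar>deriv (f j) (u j) - - h * m\<bar> \<le> h * r"
      using h abs_x[of j] by (simp add: abs_mult)
  qed
  also have "\<dots> \<le> (h * r) * (\<Sum>j\<in>UNIV. \<bar>u j\<bar> + \<bar>w j\<bar>)"
    using h r0 by (intro mult_left_mono sum_mono abs_triangle_ineq4) auto
  also have "\<dots> = (2 * \<bar>\<Delta>\<bar> * h) * r"
    using u_sum(2) w(3) by (simp add: sum.distrib)
  also have "\<dots> \<le> (2 * \<bar>\<Delta>\<bar> * h) * (2 * \<bar>\<Delta>\<bar> / ?\<kappa>)"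
    using h r by (intro mult_left_mono) auto
  also have "\<dots> = 4 * \<bar>\<Delta>\<bar>\<^sup>2 * h / ?\<kappa>"
    unfolding power2_eq_square by simp
  finally show ?thesis using w(1) by simp
qed

section \<open>Steady state of the controlled dynamics\<close>

text \<open>The power imbalance \<open>F\<close> has a limit, since the trajectories settle. That
  limit is 0: at load buses \<open>F\<close> vanishes identically, at generator buses it is inertia
  times an acceleration that tends to 0.\<close>

lemma dc_dynamics_steady_state:
  fixes VG VL :: "'v::finite set"
  assumes partition: "VG \<union> VL = UNIV"
    and dynamics: "dc_dynamics VG VL B M D p \<theta> \<omega> u"
    and settles: "settles_in VG \<theta> \<omega> v u \<theta>\<^sub>s v\<^sub>s u\<^sub>s"
  shows "p j + u\<^sub>s j = net_outflow B \<theta>\<^sub>s j"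
proof -
  define F where "F t = - D j * \<omega> j t + p j + u j t - net_outflow B (\<lambda>i. \<theta> i t) j" for t
  have lim: "(\<theta> i \<longlongrightarrow> \<theta>\<^sub>s i) at_top" "(u i \<longlongrightarrow> u\<^sub>s i) at_top" "(\<omega> i \<longlongrightarrow> 0) at_top" for i
    using settles by (auto simp: settles_in_def)
  have F: "(F \<longlongrightarrow> - D j * 0 + p j + u\<^sub>s j - net_outflow B \<theta>\<^sub>s j) at_top"
    unfolding F_def net_outflow_def by (intro tendsto_intros lim)
  have "(F \<longlongrightarrow> 0) at_top"
  proof (cases "j \<in> VG")
    case True
    have "F t = M j * deriv (\<omega> j) t" if t: "t > 0" for t
    proof -
      obtain a where a: "(\<omega> j has_real_derivative a) (at t within {0..})" "M j * a = F t"
        using dynamics True less_imp_le[OF t] unfolding dc_dynamics_def F_def by blast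
      \<comment> \<open>\<open>deriv\<close> refers to the two-sided derivative, which agrees with
        the one on \<open>{0..}\<close> at times \<open>t > 0\<close>.\<close>
      have "at t within {0..} = at t"
        using t by (intro at_within_interior) simp
      then have "deriv (\<omega> j) t = a" using a(1) by (auto intro: DERIV_imp_deriv)
      then show ?thesis using a(2) by simp
    qed
    then have "\<forall>\<^sub>F t in at_top. M j * deriv (\<omega> j) t = F t"
      by (intro eventually_mono[OF eventually_gt_at_top[of 0]]) simp
    moreover have "((\<lambda>t. M j * deriv (\<omega> j) t) \<longlongrightarrow> M j * 0) at_top"
      using settles True by (intro tendsto_intros) (auto simp: settles_in_def)
    ultimately have "(F \<longlongrightarrow> M j * 0) at_top"
      by (rule Lim_transform_eventually[rotated])
    then show ?thesis by simp
  next
    case False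
    then have "j \<in> VL" using partition by blast
    then have "F t = 0" if "t \<ge> 0" for t
      using dynamics that unfolding dc_dynamics_def F_def by metis
    then have "\<forall>\<^sub>F t in at_top. F t = 0"
      by (intro eventually_mono[OF eventually_ge_at_top[of 0]]) simp
    then show ?thesis by (rule tendsto_eventually)
  qed
  then show ?thesis
    using tendsto_unique[OF _ F] by fastforce
qed

text \<open>The control law integrates: \<open>v j t + h * \<theta> j t\<close> is conserved, and
  its value at time 0 determines the price. Continuity of the inverse marginal cost carries the
  relation to the limit.\<close>

lemma decentralized_control_steady_state:
  assumes dynamics: "dc_dynamics VG VL B M D p \<theta> \<omega> u"
    and control: "decentralized_control h f \<omega> v u" and initial: "v j 0 = 0"
    and settles: "settles_in VG \<theta> \<omega> v u \<theta>\<^sub>s v\<^sub>s u\<^sub>s"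
    and cont: "continuous_on UNIV (inv (deriv (f j)))"
  shows "u\<^sub>s j = inv (deriv (f j)) (- h * (\<theta>\<^sub>s j - \<theta> j 0))"
proof -
  have lim: "(\<theta> j \<longlongrightarrow> \<theta>\<^sub>s j) at_top" "(u j \<longlongrightarrow> u\<^sub>s j) at_top"
    using settles by (auto simp: settles_in_def)
  have "\<exists>c. \<forall>t\<in>{0..}. v j t + h * \<theta> j t = c"
  proof (rule has_field_derivative_zero_constant)
    fix t :: real assume "t \<in> {0..}"
    then have "(v j has_real_derivative - h * \<omega> j t) (at t within {0..})"
      "(\<theta> j has_real_derivative \<omega> j t) (at t within {0..})"
      using dynamics control by (auto simp: dc_dynamics_def decentralized_control_def)
    from DERIV_add[OF this(1) DERIV_cmult[OF this(2), of h]]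
    show "((\<lambda>t. v j t + h * \<theta> j t) has_real_derivative 0) (at t within {0..})" by simp
  qed simp
  then have "v j t = - h * (\<theta> j t - \<theta> j 0)" if "t \<ge> 0" for t
    using initial that by (force simp: algebra_simps)
  then have "\<forall>\<^sub>F t in at_top. inv (deriv (f j)) (- h * (\<theta> j t - \<theta> j 0)) = u j t"
    using control unfolding decentralized_control_def
    by (intro eventually_mono[OF eventually_ge_at_top[of 0]]) simp
  moreover have "((\<lambda>t. inv (deriv (f j)) (- h * (\<theta> j t - \<theta> j 0)))
      \<longlongrightarrow> inv (deriv (f j)) (- h * (\<theta>\<^sub>s j - \<theta> j 0))) at_top"
    by (rule continuous_on_tendsto_compose[OF cont]) (auto intro!: tendsto_intros lim)
  ultimately have "(u j \<longlongrightarrow> inv (deriv (f j)) (- h * (\<theta>\<^sub>s j - \<theta> j 0))) at_top"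
    by (rule Lim_transform_eventually[rotated])
  then show ?thesis
    using tendsto_unique[OF _ lim(2)] by simp
qed

theorem corollary1:
  fixes E :: "('v::finite \<times> 'v) set"
    and VG VL :: "'v set"
    and B :: "'v \<Rightarrow> 'v \<Rightarrow> real"
    and M D p\<^sub>0 p \<theta>\<^sub>0 :: "'v \<Rightarrow> real"
    and f :: "'v \<Rightarrow> real \<Rightarrow> real"
    and h \<Delta>p :: real
    and k :: 'v
    and \<theta> \<omega> v u :: "'v \<Rightarrow> real \<Rightarrow> real"
    and \<theta>\<^sub>s v\<^sub>s u\<^sub>s :: "'v \<Rightarrow> real"
  assumes two_buses: "CARD('v) \<ge> 2"
    and graph: "connected_simple_graph E"
    and partition: "VG \<union> VL = UNIV" "VG \<inter> VL = {}"
    and susceptances: "line_susceptances E B"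
    and inertia: "\<And>j. j \<in> VG \<Longrightarrow> M j > 0"
    and damping: "\<And>j. D j > 0"
    and strictly_convex_cost: "\<And>j. strictly_convex (f j)"
    and differentiable_cost: "\<And>j. f j differentiable_on UNIV"
    and cost_min: "\<And>j x. f j 0 \<le> f j x"
    and cost_zero: "\<And>j. f j 0 = 0"
    and marginal_bij: "\<And>j. bij (deriv (f j))"
    and gain: "h > 0"
    and balanced_before: "(\<Sum>j\<in>UNIV. p\<^sub>0 j) = 0"
    and steady_before: "\<And>j. p\<^sub>0 j = net_outflow B \<theta>\<^sub>0 j"
    and perturbed: "p k = p\<^sub>0 k + \<Delta>p"
    and unperturbed: "\<And>j. j \<noteq> k \<Longrightarrow> p j = p\<^sub>0 j"
    and dynamics: "dc_dynamics VG VL B M D p \<theta> \<omega> u"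
    and control: "decentralized_control h f \<omega> v u"
    and initial: "\<And>j. \<theta> j 0 = \<theta>\<^sub>0 j" "\<And>j. v j 0 = 0" "\<And>j. u j 0 = 0"
      "\<And>j. j \<in> VG \<Longrightarrow> \<omega> j 0 = 0"
    and steady_after: "settles_in VG \<theta> \<omega> v u \<theta>\<^sub>s v\<^sub>s u\<^sub>s"
  shows "total_cost f u\<^sub>s \<le> optimal_cost B p f +
    4 * \<Delta>p\<^sup>2 * real CARD('v) * h / (min_susceptance E B * algebraic_connectivity E)"
proof -
  have convex: "convex_on UNIV (f j)" for j
    by (rule strictly_convex_imp_convex_on[OF strictly_convex_cost])
  have zero: "deriv (f j) 0 = 0" for j
    by (rule deriv_zero_at_minimum[OF differentiable_cost cost_min])
  have mono: "strict_mono (deriv (f j))" for j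
    by (rule convex_on_deriv_strict_mono[OF convex differentiable_cost bij_is_inj[OF marginal_bij]])
  define \<phi> where "\<phi> j = \<theta>\<^sub>s j - \<theta>\<^sub>0 j" for j
  have p: "p j = p\<^sub>0 j + (if j = k then \<Delta>p else 0)" for j
    using perturbed unperturbed by simp
  have u: "u\<^sub>s j = inv (deriv (f j)) (- h * \<phi> j)" for j
    using decentralized_control_steady_state[OF dynamics control initial(2) steady_after
        continuous_inv_bij_strict_mono[OF mono marginal_bij]] initial(1)
    by (simp add: \<phi>_def)
  \<comment> \<open>Subtracting the balance before the perturbation cancels \<open>p\<^sub>0\<close>
    and leaves a single-bus injection.\<close>
  have flow: "(if j = k then \<Delta>p else 0) + u\<^sub>s j = net_outflow B \<phi> j" for j
    using dc_dynamics_steady_state[OF partition(1) dynamics steady_after, of j]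
    unfolding \<phi>_def net_outflow_diff by (simp add: p steady_before[symmetric] split: if_splits)
  have "(\<Sum>j\<in>UNIV. p j) = \<Delta>p"
    using balanced_before by (simp add: p sum.distrib)
  then have "total_cost f u\<^sub>s \<le> optimal_cost B p f +
      4 * \<Delta>p\<^sup>2 * h / (min_susceptance E B * algebraic_connectivity E)"
    using steady_state_cost_gap[OF two_buses graph susceptances convex differentiable_cost zero
        marginal_bij gain u flow] by blast
  \<comment> \<open>The static bound has no factor for the number of buses; the stated one follows
    because this number is at least 1.\<close>
  also have "4 * \<Delta>p\<^sup>2 * h / (min_susceptance E B * algebraic_connectivity E) \<le>
      4 * \<Delta>p\<^sup>2 * real CARD('v) * h / (min_susceptance E B * algebraic_connectivity E)"
  proof (rule divide_right_mono)
    have "4 * \<Delta>p\<^sup>2 * h * 1 \<le> 4 * \<Delta>p\<^sup>2 * h * real CARD('v)"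
      using gain two_buses by (intro mult_left_mono) auto
    then show "4 * \<Delta>p\<^sup>2 * h \<le> 4 * \<Delta>p\<^sup>2 * real CARD('v) * h" by (simp add: ac_simps)
    show "0 \<le> min_susceptance E B * algebraic_connectivity E"
      using min_susceptance_pos[OF two_buses graph susceptances]
        algebraic_connectivity_poincare(1)[OF two_buses graph] by simp
  qed
  finally show ?thesis by simp
qed

end
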